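(* There exist a real number $0 < p < 1$, a sequence $(F_n)_{n \in \mathbb{N}}$ of reversible cellular automata on $\{0,1\}^{\mathbb{Z}}$ and a word $w \in \{0,1\}^*$ such that $(F_n \mu_p)([w]) \longrightarrow 0$ as $n \to \infty$, where $\mu_p$ is the Bernoulli product measure on $\{0,1\}^{\mathbb{Z}}$ in which each coordinate equals $1$ with probability $p$. In particular, no weak-* limit point of the sequence $(F_n \mu_p)_{n \in \mathbb{N}}$ has full support.
   Context: Let $\Sigma$ be a finite alphabet. A cellular automaton (CA) is a function $F : \Sigma^{\mathbb{Z}} \to \Sigma^{\mathbb{Z}}$ defined by a local rule $f : \Sigma^{1+r} \to \Sigma$, for some radius $r \geq 0$, by $F(x)_i = f(x_{[i,i+r]})$ for all $x \in \Sigma^{\mathbb{Z}}$ and $i \in \mathbb{Z}$, where $x_{[i,i+r]} = x_i x_{i+1} \cdots x_{i+r}$. (Neighborhoods are taken one-sided by convention only: the notions considered are invariant under composition with shift maps.) A CA is reversible if it is bijective; its inverse is then also a continuous shift-commuting map, i.e. a CA with a possibly two-sided neighborhood. For a word $w \in \Sigma^*$, the cylinder $[w]$ is the set of $x \in \Sigma^{\mathbb{Z}}$ with $x_{[0,|w|-1]} = w$. All probability measures on $\Sigma^{\mathbb{Z}}$ are assumed shift-invariant. The image of a measure $\mu$ under $F$ is given by $F\mu([u]) = \mu(F^{-1}([u]))$. A sequence of measures $\nu_n$ converges weak-* to $\nu$ if $\nu_n([u]) \to \nu([u])$ for all words $u$; a weak-* limit point is the limit of a convergent subsequence. A measure $\nu$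 has full support if $\nu([u]) > 0$ for all words $u$. *)

theory Defs
  imports "HOL-Probability.Probability"
begin

type_synonym 'a config = "int \<Rightarrow> 'a"

(* The local rule is given on lists; only its values on words of length r + 1 matter. *)
definition cellular_automaton :: "('a::finite config \<Rightarrow> 'a config) \<Rightarrow> bool" where
  "cellular_automaton F \<longleftrightarrow>
     (\<exists>(r::nat) (f :: 'a list \<Rightarrow> 'a).
        \<forall>x i. F x i = f (map (\<lambda>k. x (i + int k)) [0..<r + 1]))"

definition reversible_ca :: "('a::finite config \<Rightarrow> 'a config) \<Rightarrow> bool" where
  "reversible_ca F \<longleftrightarrow> cellular_automaton F \<and> bij F"

definition cylinder :: "'a list \<Rightarrow> 'a config set" where
  "cylinder w = {x. \<forall>i < length w. x (int i) = w ! i}"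

definition config_space :: "'a::finite config measure" where
  "config_space = (\<Pi>\<^sub>M i\<in>UNIV. count_space UNIV)"

definition shift :: "'a config \<Rightarrow> 'a config" where
  "shift x = (\<lambda>i. x (i + 1))"

definition shift_invariant_prob :: "'a::finite config measure \<Rightarrow> bool" where
  "shift_invariant_prob \<nu> \<longleftrightarrow>
     prob_space \<nu> \<and> sets \<nu> = sets config_space \<and> distr \<nu> config_space shift = \<nu>"

definition image_measure ::
    "('a::finite config \<Rightarrow> 'a config) \<Rightarrow> 'a config measure \<Rightarrow> 'a config measure" where
  "image_measure F \<mu> = distr \<mu> config_space F"

definition weak_star_converges ::
    "(nat \<Rightarrow> 'a::finite config measure) \<Rightarrow> 'a config measure \<Rightarrow> bool" where
  "weak_star_converges \<mu> \<nu> \<longleftrightarrow>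
     (\<forall>u. (\<lambda>n. measure (\<mu> n) (cylinder u)) \<longlonglongrightarrow> measure \<nu> (cylinder u))"

definition weak_star_limit_point ::
    "(nat \<Rightarrow> 'a::finite config measure) \<Rightarrow> 'a config measure \<Rightarrow> bool" where
  "weak_star_limit_point \<mu> \<nu> \<longleftrightarrow>
     shift_invariant_prob \<nu> \<and>
     (\<exists>s :: nat \<Rightarrow> nat. strict_mono s \<and> weak_star_converges (\<mu> \<circ> s) \<nu>)"

definition full_support :: "'a::finite config measure \<Rightarrow> bool" where
  "full_support \<nu> \<longleftrightarrow> (\<forall>u. measure \<nu> (cylinder u) > 0)"

(* The alphabet {0,1} is bool, with True playing the role of 1. *)
definition bernoulli_measure :: "real \<Rightarrow> bool config measure" where
  "bernoulli_measure p = (\<Pi>\<^sub>M i\<in>UNIV. measure_pmf (bernoulli_pmf p))"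

lemma space_config_space [simp]: "space config_space = UNIV"
  by (simp add: config_space_def space_PiM)

lemma sets_bernoulli_measure: "sets (bernoulli_measure p) = sets config_space"
  unfolding bernoulli_measure_def config_space_def by (rule sets_PiM_cong) simp_all

lemma measurable_coordinate:
  "(\<lambda>x. x i) \<in> config_space \<rightarrow>\<^sub>M count_space UNIV"
  unfolding config_space_def by (rule measurable_component_singleton) simp

lemma cylinder_in_sets: "cylinder u \<in> sets config_space"
proof -
  have 1: "{x. x i = a} \<in> sets config_space" for i :: int and a :: 'a
    using measurable_sets[OF measurable_coordinate[of i], of "{a}"]
    by (simp add: vimage_def)
  have "cylinder u = (\<Inter>i\<in>{..<length u}. {x. x (int i) = u ! i}) \<inter> space config_space"
    by (auto simp: cylinder_def)
  also have "\<dots> \<in> sets config_space"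
    using sets.finite_INT[of "{..<length u}" "\<lambda>i. {x. x (int i) = u ! i}" config_space] 1
    by (cases "length u = 0") (auto simp flip: space_config_space)
  finally show ?thesis .
qed

lemma measurable_window:
  fixes g :: "'b \<Rightarrow> int"
  shows "(\<lambda>x. map (\<lambda>k. x (g k)) ks) \<in> (config_space :: 'a::finite config measure) \<rightarrow>\<^sub>M count_space UNIV"
proof (induction ks)
  case (Cons k ks)
  have "(\<lambda>x. (x (g k), map (\<lambda>k. x (g k)) ks))
          \<in> (config_space :: 'a config measure) \<rightarrow>\<^sub>M count_space UNIV \<Otimes>\<^sub>M count_space UNIV"
    by (intro measurable_Pair measurable_coordinate Cons.IH)
  then have "(\<lambda>x. (x (g k), map (\<lambda>k. x (g k)) ks)) \<in> (config_space :: 'a config measure) \<rightarrow>\<^sub>M count_space UNIV"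
    by (simp only: pair_measure_countable[OF countableI_type countableI_type] UNIV_Times_UNIV)
  then have "(\<lambda>x. (\<lambda>(a, as). a # as) (x (g k), map (\<lambda>k. x (g k)) ks))
               \<in> (config_space :: 'a config measure) \<rightarrow>\<^sub>M count_space UNIV"
    by (rule measurable_compose) simp
  then show ?case by (simp only: prod.case list.map)
qed simp

lemma cellular_automaton_measurable:
  assumes "cellular_automaton F"
  shows "F \<in> config_space \<rightarrow>\<^sub>M config_space"
proof -
  obtain r f where F: "\<And>x i. F x i = f (map (\<lambda>k. x (i + int k)) [0..<r + 1])"
    using assms unfolding cellular_automaton_def by blast
  have "(\<lambda>x. F x i) \<in> config_space \<rightarrow>\<^sub>M count_space UNIV" for i
    unfolding F by (rule measurable_compose[OF measurable_window]) simp
  then have "(\<lambda>x i. F x i) \<in> config_space \<rightarrow>\<^sub>M (\<Pi>\<^sub>M i\<in>UNIV. count_space UNIV)"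
    by (intro measurable_PiM_single') auto
  then show ?thesis by (simp add: config_space_def)
qed

lemma measure_image_cylinder:
  assumes "cellular_automaton F" and "sets \<mu> = sets config_space"
  shows "measure (image_measure F \<mu>) (cylinder u) = measure \<mu> (F -` cylinder u)"
proof -
  have "F \<in> \<mu> \<rightarrow>\<^sub>M config_space"
    using cellular_automaton_measurable[OF assms(1)] assms(2)
    by (simp cong: measurable_cong_sets)
  moreover have "space \<mu> = UNIV"
    using sets_eq_imp_space_eq[OF assms(2)] by simp
  ultimately show ?thesis
    unfolding image_measure_def by (simp add: measure_distr cylinder_in_sets)
qed

lemma shift_invariant_bernoulli: "shift_invariant_prob (bernoulli_measure p)"
proof -
  interpret product_prob_space "\<lambda>_::int. measure_pmf (bernoulli_pmf p)" UNIV
    by unfold_locales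
  have "distr (bernoulli_measure p) (bernoulli_measure p) (\<lambda>x. \<lambda>i\<in>UNIV. x (i + 1))
          = bernoulli_measure p"
    unfolding bernoulli_measure_def
    by (rule distr_PiM_reindex) (auto simp: prob_space_measure_pmf inj_on_def)
  moreover have "distr (bernoulli_measure p) (bernoulli_measure p) (\<lambda>x. \<lambda>i\<in>UNIV. x (i + 1))
       = distr (bernoulli_measure p) config_space shift"
    by (rule distr_cong) (auto simp: sets_bernoulli_measure shift_def)
  moreover have "prob_space (bernoulli_measure p)"
    unfolding bernoulli_measure_def by (rule prob_space_PiM) (rule prob_space_measure_pmf)
  ultimately show ?thesis
    by (simp add: shift_invariant_prob_def sets_bernoulli_measure)
qed

end

theory Submission
  imports Defs "HOL-Library.Sublist"
begin

text \<open>
  Cut a configuration at the occurrences of the unbordered marker \<open>m = 1 1 0\<dots>0\<close>, and apply to each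
  word between consecutive markers a length-preserving involution of the marker-free words. This keeps
  the markers in place, so it is an involution of the configuration space; bounding the gap length
  makes it a cellular automaton. For \<open>p = 49/625\<close> the entropy of the Bernoulli measure is below that
  of the golden mean shift, so there are at least as many words without \<open>11\<close> of length \<open>k\<close> (at least
  \<open>(25/16) ^ k\<close>) as words of probability at least \<open>(16/25) ^ k\<close>, and the involution can send all
  of the latter to words without \<open>11\<close>. As \<open>m\<close> contains \<open>11\<close>, these are marker-free. A fixed pair
  of adjacent cells then shows \<open>11\<close> only if it lies near a marker or in a too long gap, or if the gap
  content is unlikely; all of this becomes improbable as the marker gets longer.
\<close>

section \<open>Windows of configurations\<close>

definition window :: "'a config \<Rightarrow> int \<Rightarrow> nat \<Rightarrow> 'a list" where
  "window x a k = map (\<lambda>j. x (a + int j)) [0..<k]"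

lemma length_window [simp]: "length (window x a k) = k"
  by (simp add: window_def)

lemma nth_window [simp]: "j < k \<Longrightarrow> window x a k ! j = x (a + int j)"
  by (simp add: window_def)

lemma drop_window: "drop j (window x a k) = window x (a + int j) (k - j)"
  by (rule nth_equalityI) (auto simp: algebra_simps)

lemma take_window: "j \<le> k \<Longrightarrow> take j (window x a k) = window x a j"
  by (rule nth_equalityI) auto

lemma window_add: "window x a (k + l) = window x a k @ window x (a + int k) l"
  by (rule nth_equalityI) (auto simp: nth_append)

lemma window_eqI:
  assumes "\<And>i. a \<le> i \<Longrightarrow> i < a + int k \<Longrightarrow> x i = y i"
  shows "window x a k = window y a k"
  by (rule nth_equalityI) (auto intro: assms)

lemma window_translate: "window (\<lambda>j. x (j + d)) a k = window x (a + d) k"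
  by (rule nth_equalityI) (auto simp: algebra_simps)

lemma sublist_window_iff:
  "sublist m (window x a k) \<longleftrightarrow>
     (\<exists>s. a \<le> s \<and> s + int (length m) \<le> a + int k \<and> window x s (length m) = m)"
proof
  assume "sublist m (window x a k)"
  then obtain ps ss where eq: "window x a k = ps @ m @ ss"
    by (auto simp: sublist_def)
  have len: "k = length ps + length m + length ss"
    using arg_cong[OF eq, of length] by simp
  have "window x (a + int (length ps)) (length m) = take (length m) (drop (length ps) (window x a k))"
    using len by (simp add: drop_window take_window)
  then have "window x (a + int (length ps)) (length m) = m"
    unfolding eq by simp
  then show "\<exists>s. a \<le> s \<and> s + int (length m) \<le> a + int k \<and> window x s (length m) = m"
    using len by (intro exI[of _ "a + int (length ps)"]) auto
next
  assume "\<exists>s. a \<le> s \<and> s + int (length m) \<le> a + int k \<and> window x s (length m) = m"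
  then obtain s where s: "a \<le> s" "s + int (length m) \<le> a + int k" "window x s (length m) = m"
    by blast
  define j where "j = nat (s - a)"
  have "m = take (length m) (drop j (window x a k))"
    using s by (simp add: drop_window take_window j_def)
  then show "sublist m (window x a k)"
    by (metis sublist_take sublist_drop sublist_order.order_trans)
qed

text \<open>The local rule turns a word back into a configuration and evaluates \<open>G\<close>
  there at 0. Whatever \<open>l ! nat j\<close> yields outside the word is harmless, since by
  \<open>local\<close> only positions 0 to \<open>r\<close> matter.\<close>

lemma cellular_automatonI:
  fixes G :: "'a::finite config \<Rightarrow> 'a config"
  assumes translate: "\<And>x d i. G (\<lambda>j. x (j + d)) i = G x (i + d)"
    and local: "\<And>x y. (\<And>j. 0 \<le> j \<Longrightarrow> j \<le> int r \<Longrightarrow> x j = y j) \<Longrightarrow> G x 0 = G y 0"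
  shows "cellular_automaton G"
proof -
  have "G x i = G (\<lambda>j. map (\<lambda>k. x (i + int k)) [0..<r + 1] ! nat j) 0" for x i
  proof -
    have "G x i = G (\<lambda>j. x (j + i)) 0"
      by (simp add: translate)
    also have "\<dots> = G (\<lambda>j. map (\<lambda>k. x (i + int k)) [0..<r + 1] ! nat j) 0"
    proof (rule local)
      fix j :: int assume "0 \<le> j" "j \<le> int r"
      then show "x (j + i) = map (\<lambda>k. x (i + int k)) [0..<r + 1] ! nat j"
        by (subst nth_map) (auto simp: algebra_simps simp del: upt_Suc)
    qed
    finally show ?thesis .
  qed
  then show ?thesis
    unfolding cellular_automaton_def by (intro exI[of _ r] exI[of _ "\<lambda>l. G (\<lambda>j. l ! nat j) 0"]) blast
qed

section \<open>Refilling the gaps between markers\<close>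

text \<open>Unborderedness keeps markers disjoint, and \<open>sublist_\<sigma>\<close> prevents a
  refilled gap from containing a new marker. Together they fix the marker positions, so that the
  involution \<open>\<sigma>\<close> on words lifts to an involution on configurations.\<close>

locale gap_refill =
  fixes m :: "'a::finite list" and K :: nat and \<sigma> :: "'a list \<Rightarrow> 'a list"
  assumes unbordered: "\<And>j. 0 < j \<Longrightarrow> j < length m \<Longrightarrow> drop j m \<noteq> take (length m - j) m"
    and length_\<sigma> [simp]: "\<And>v. length (\<sigma> v) = length v"
    and \<sigma>_\<sigma> [simp]: "\<And>v. \<sigma> (\<sigma> v) = v"
    and sublist_\<sigma>: "\<And>v. sublist m (\<sigma> v) \<longleftrightarrow> sublist m v"
begin

abbreviation M :: int where "M \<equiv> int (length m)"

definition marked :: "'a config \<Rightarrow> int \<Rightarrow> bool" where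
  "marked x s \<longleftrightarrow> window x s (length m) = m"

text \<open>The bound \<open>K\<close> is what makes refilling local: longer gaps do not count and
  stay unchanged.\<close>

definition gap :: "'a config \<Rightarrow> int \<Rightarrow> int \<Rightarrow> bool" where
  "gap x s t \<longleftrightarrow> marked x s \<and> marked x t \<and> s < t \<and> t \<le> s + int K \<and>
     (\<forall>r. s < r \<and> r < t \<longrightarrow> \<not> marked x r)"

definition covers :: "'a config \<Rightarrow> int \<Rightarrow> int \<Rightarrow> int \<Rightarrow> bool" where
  "covers x i s t \<longleftrightarrow> gap x s t \<and> s + M \<le> i \<and> i < t"

definition content :: "'a config \<Rightarrow> int \<Rightarrow> int \<Rightarrow> 'a list" where
  "content x s t = window x (s + M) (nat (t - s - M))"

definition refill :: "'a config \<Rightarrow> 'a config" where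
  "refill x i = (if \<exists>s t. covers x i s t
     then THE b. \<exists>s t. covers x i s t \<and> b = \<sigma> (content x s t) ! nat (i - s - M)
     else x i)"

lemma marked_cong:
  assumes "\<And>i. s \<le> i \<Longrightarrow> i < s + M \<Longrightarrow> x i = y i"
  shows "marked x s \<longleftrightarrow> marked y s"
  using window_eqI[of s "length m" x y] assms by (simp add: marked_def)

text \<open>Two markers overlapping at distance \<open>j\<close> would make a proper suffix of
  \<open>m\<close> equal to a prefix, that is, a border.\<close>

lemma marked_disjoint:
  assumes "marked x s" "marked x t" "s < t"
  shows "s + M \<le> t"
proof (rule ccontr)
  assume "\<not> s + M \<le> t"
  define j where "j = nat (t - s)"
  have j: "0 < j" "j < length m" "t = s + int j"
    using assms \<open>\<not> s + M \<le> t\<close> by (auto simp: j_def)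
  have "drop j (window x s (length m)) = take (length m - j) (window x t (length m))"
    using j by (simp add: drop_window take_window)
  then show False
    using unbordered[OF j(1,2)] assms by (simp add: marked_def)
qed

text \<open>If \<open>s < s'\<close>, then \<open>s' \<le> i < t\<close> puts the marker at
  \<open>s'\<close> strictly inside the first gap. Right ends are compared in the same way. This
  makes the description in \<open>refill\<close> well defined.\<close>

lemma covers_unique:
  assumes "covers x i s t" "covers x i s' t'"
  shows "s = s'" "t = t'"
  using assms unfolding covers_def gap_def
  by (smt (verit) of_nat_0_le_iff)+

lemma refill_covered:
  assumes "covers x i s t"
  shows "refill x i = \<sigma> (content x s t) ! nat (i - s - M)"
proof -
  have "(THE b. \<exists>s t. covers x i s t \<and> b = \<sigma> (content x s t) ! nat (i - s - M))
      = \<sigma> (content x s t) ! nat (i - s - M)"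
    using assms covers_unique[OF assms] by (intro the_equality) blast+
  then show ?thesis
    using assms by (auto simp: refill_def)
qed

lemma refill_uncovered: "\<not> (\<exists>s t. covers x i s t) \<Longrightarrow> refill x i = x i"
  by (auto simp: refill_def)

lemma content_refill:
  assumes "gap x s t"
  shows "content (refill x) s t = \<sigma> (content x s t)"
proof (rule nth_equalityI)
  fix j assume "j < length (content (refill x) s t)"
  then have j: "j < nat (t - s - M)"
    by (simp add: content_def)
  then have "covers x (s + M + int j) s t"
    using assms by (auto simp: covers_def)
  from refill_covered[OF this] show "content (refill x) s t ! j = \<sigma> (content x s t) ! j"
    using j by (simp add: content_def)
qed (simp add: content_def)

lemma not_sublist_content:
  assumes "gap x s t" "m \<noteq> []"
  shows "\<not> sublist m (content x s t)"
proof
  assume "sublist m (content x s t)"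
  then obtain r where "s + M \<le> r" "r + M \<le> s + M + int (nat (t - s - M))" "marked x r"
    unfolding content_def sublist_window_iff marked_def by blast
  \<comment> \<open>The first fact ensures that \<open>nat\<close> truncates nothing; the second
    separates \<open>r\<close> from both ends of the gap.\<close>
  moreover have "s + M \<le> t" "0 < M"
    using assms marked_disjoint unfolding gap_def by auto
  ultimately have "s < r" "r < t" "marked x r"
    by linarith+
  then show False
    using assms by (auto simp: gap_def)
qed

text \<open>If a gap from \<open>s\<close> to \<open>t\<close> covered the cell \<open>i\<close>,
  then \<open>s + M \<le> i < r + M\<close> and \<open>r \<le> i < t\<close> would place the marker
  at \<open>r\<close> strictly between its ends.\<close>

lemma refill_on_marker:
  assumes "marked x r" "r \<le> i" "i < r + M"
  shows "refill x i = x i"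
proof (rule refill_uncovered, clarify)
  fix s t assume "covers x i s t"
  then show False
    using assms unfolding covers_def gap_def by (smt (verit))
qed

lemma marked_refill_if_marked: "marked x r \<Longrightarrow> marked (refill x) r"
  using marked_cong[of r "refill x" x] refill_on_marker by blast

text \<open>Old markers survive because their cells are never covered. A new one would have to meet
  a refilled cell; disjointness from the surviving ends of that gap forces it wholly into the new
  content, and by \<open>sublist_\<sigma>\<close> the old content would then contain
  \<open>m\<close> too.\<close>

lemma marked_refill:
  assumes "m \<noteq> []"
  shows "marked (refill x) r \<longleftrightarrow> marked x r"
proof
  assume r: "marked (refill x) r"
  show "marked x r"
  proof (cases "\<exists>i s t. r \<le> i \<and> i < r + M \<and> covers x i s t")
    case True
    then obtain i s t where i: "r \<le> i" "i < r + M" and c: "covers x i s t"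
      by blast
    have st: "gap x s t" "s + M \<le> i" "i < t" "marked x s" "marked x t"
      using c by (auto simp: covers_def gap_def)
    have "marked (refill x) s" "marked (refill x) t"
      using st marked_refill_if_marked by blast+
    \<comment> \<open>Disjointness is used in \<open>refill x\<close>, where \<open>r\<close>,
      \<open>s\<close> and \<open>t\<close> are all marked.\<close>
    note d = marked_disjoint[OF r this(1)] marked_disjoint[OF this(1) r]
      marked_disjoint[OF r this(2)] marked_disjoint[OF this(2) r]
    have "s \<noteq> r \<Longrightarrow> s + M \<le> r \<and> r + M \<le> t"
      using d i st by linarith
    moreover have False if "s + M \<le> r" "r + M \<le> t"
    proof -
      have "sublist m (content (refill x) s t)"
        using that r unfolding content_def sublist_window_iff marked_def
        by (intro exI[of _ r]) auto
      then show False
        using not_sublist_content[OF st(1) assms] content_refill[OF st(1)] sublist_\<sigma> by simp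
    qed
    ultimately show ?thesis
      using st by blast
  next
    case False
    then show ?thesis
      using r marked_cong[of r "refill x" x] refill_uncovered by blast
  qed
qed (rule marked_refill_if_marked)

text \<open>Markers, hence gaps, are the same before and after refilling, so the second pass applies
  \<open>\<sigma>\<close> again to the same stretches.\<close>

lemma refill_refill:
  assumes "m \<noteq> []"
  shows "refill (refill x) = x"
proof
  fix i
  have gap: "gap (refill x) s t \<longleftrightarrow> gap x s t" for s t
    by (simp add: gap_def marked_refill[OF assms])
  then have cov: "covers (refill x) i s t \<longleftrightarrow> covers x i s t" for s t
    by (simp add: covers_def)
  show "refill (refill x) i = x i"
  proof (cases "\<exists>s t. covers x i s t")
    case True
    then obtain s t where c: "covers x i s t"
      by blast
    then have "refill (refill x) i = \<sigma> (content (refill x) s t) ! nat (i - s - M)"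
      by (intro refill_covered) (simp add: cov)
    also have "\<dots> = content x s t ! nat (i - s - M)"
      using c by (simp add: content_refill covers_def)
    also have "\<dots> = x i"
      using c by (simp add: content_def covers_def)
    finally show ?thesis .
  next
    case False
    then show ?thesis
      by (simp add: refill_uncovered cov)
  qed
qed

lemma refill_translate: "refill (\<lambda>j. x (j + d)) i = refill x (i + d)"
proof -
  have m: "marked (\<lambda>j. x (j + d)) s \<longleftrightarrow> marked x (s + d)" for s
    by (simp add: marked_def window_translate)
  have g: "gap (\<lambda>j. x (j + d)) s t \<longleftrightarrow> gap x (s + d) (t + d)" for s t
  proof -
    have "(\<forall>r. s < r \<and> r < t \<longrightarrow> \<not> marked x (r + d)) \<longleftrightarrow>
          (\<forall>r. s + d < r \<and> r < t + d \<longrightarrow> \<not> marked x r)"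
      by (metis add_less_cancel_right diff_add_cancel)
    then show ?thesis
      by (auto simp: gap_def m)
  qed
  have c: "covers (\<lambda>j. x (j + d)) i s t \<longleftrightarrow> covers x (i + d) (s + d) (t + d)" for s t
    by (auto simp: covers_def g)
  show ?thesis
  proof (cases "\<exists>s t. covers (\<lambda>j. x (j + d)) i s t")
    case True
    then obtain s t where st: "covers (\<lambda>j. x (j + d)) i s t"
      by blast
    moreover have "content (\<lambda>j. x (j + d)) s t = content x (s + d) (t + d)"
      by (simp add: content_def window_translate algebra_simps)
    ultimately show ?thesis
      using refill_covered[OF st] refill_covered[OF st[unfolded c]] by simp
  next
    case False
    moreover have "\<not> (\<exists>s t. covers x (i + d) s t)"
      using False unfolding c by (metis diff_add_cancel)
    ultimately show ?thesis
      by (simp add: refill_uncovered)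
  qed
qed

text \<open>A gap covering \<open>i\<close> has length at most \<open>K\<close>, so it starts after
  \<open>i - K\<close> and ends by \<open>i + K\<close>; the extra \<open>M\<close> accommodates the
  marker at its right end.\<close>

lemma covers_local:
  assumes "\<And>j. i - int K \<le> j \<Longrightarrow> j \<le> i + int K + M \<Longrightarrow> x j = y j" "covers x i s t"
  shows "covers y i s t" "content y s t = content x s t"
proof -
  have st: "gap x s t" "s + M \<le> i" "i < t" "t \<le> s + int K"
    using assms(2) by (auto simp: covers_def gap_def)
  have "marked x r \<longleftrightarrow> marked y r" if "s \<le> r" "r \<le> t" for r
    by (rule marked_cong) (use st that in \<open>auto intro!: assms(1)\<close>)
  then have "gap y s t"
    using st(1) by (auto simp: gap_def)
  then show "covers y i s t"
    using st by (simp add: covers_def)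
  show "content y s t = content x s t"
    unfolding content_def
    by (rule window_eqI) (use st in \<open>auto intro!: assms(1)[symmetric]\<close>)
qed

lemma refill_local:
  assumes "\<And>j. i - int K \<le> j \<Longrightarrow> j \<le> i + int K + M \<Longrightarrow> x j = y j"
  shows "refill x i = refill y i"
proof (cases "\<exists>s t. covers x i s t")
  case True
  then obtain s t where st: "covers x i s t"
    by blast
  show ?thesis
    using refill_covered[OF st] refill_covered[OF covers_local(1)[of i x y, OF _ st]]
      covers_local(2)[of i x y, OF _ st] assms by simp
next
  case False
  moreover have "\<not> (\<exists>s t. covers y i s t)"
    using False covers_local(1)[of i y x] assms by metis
  ultimately show ?thesis
    using assms[of i] by (simp add: refill_uncovered)
qed

text \<open>The translation by \<open>K\<close> makes the neighbourhood one-sided.\<close>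

lemma reversible_ca_refill:
  assumes "m \<noteq> []"
  shows "reversible_ca (\<lambda>x i. refill x (i + int K))"
proof -
  have "cellular_automaton (\<lambda>x i. refill x (i + int K))"
  proof (rule cellular_automatonI)
    show "refill (\<lambda>j. x (j + d)) (i + int K) = refill x (i + d + int K)" for x d i
      by (simp add: refill_translate algebra_simps)
    show "refill x (0 + int K) = refill y (0 + int K)"
      if "\<And>j. 0 \<le> j \<Longrightarrow> j \<le> int (2 * K + length m) \<Longrightarrow> x j = y j" for x y
      by (rule refill_local) (use that in auto)
  qed
  moreover have "bij (\<lambda>x i. refill x (i + int K))"
    by (rule o_bij[where g = "\<lambda>y. refill (\<lambda>j. y (j - int K))"])
      (auto simp: fun_eq_iff refill_refill[OF assms])
  ultimately show ?thesis
    by (simp add: reversible_ca_def)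
qed

end

section \<open>Counting words\<close>

lemma finite_words: "finite {v :: 'a::finite list. length v = k}"
  using finite_lists_length_eq[of "UNIV :: 'a set" k] by simp

text \<open>Expanding the power gives one term per word. This is applied to the letter probabilities
  and to their square roots.\<close>

lemma sum_words_prod_list:
  fixes f :: "'a::finite \<Rightarrow> 'b::comm_semiring_1"
  shows "(\<Sum>v | length v = k. prod_list (map f v)) = (\<Sum>a\<in>UNIV. f a) ^ k"
proof (induction k)
  case (Suc k)
  have eq: "{v :: 'a list. length v = Suc k} = (\<lambda>(a, v). a # v) ` (UNIV \<times> {v. length v = k})"
    by (auto simp: length_Suc_conv)
  have "(\<Sum>v | length v = Suc k. prod_list (map f v))
      = (\<Sum>(a, v)\<in>UNIV \<times> {v. length v = k}. f a * prod_list (map f v))"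
    unfolding eq by (subst sum.reindex) (auto simp: inj_on_def intro!: sum.cong)
  also have "\<dots> = (\<Sum>a\<in>UNIV. f a) * (\<Sum>v | length v = k. prod_list (map f v))"
    by (simp add: sum_product sum.cartesian_product)
  finally show ?case
    by (simp add: Suc)
qed simp

text \<open>The cardinality bound gives an injection of \<open>T - A\<close> into
  \<open>A - T\<close>. Exchanging each point with its image and fixing everything else is an
  involution; points of \<open>T\<close> already in \<open>A\<close> do not move.\<close>

lemma swap_into:
  assumes "finite A" "finite T" "card T \<le> card A"
  obtains \<sigma> where "\<And>v. \<sigma> (\<sigma> v) = v" "\<And>v. v \<in> T \<Longrightarrow> \<sigma> v \<in> A"
    "\<And>v. v \<notin> T \<union> A \<Longrightarrow> \<sigma> v = v" "\<And>v. v \<in> T \<union> A \<Longrightarrow> \<sigma> v \<in> T \<union> A"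
proof -
  have "card (T - A) \<le> card (A - T)"
    using assms by (simp add: card_Diff_subset_Int Int_commute diff_le_mono)
  then obtain f where f: "f ` (T - A) \<subseteq> A - T" "inj_on f (T - A)"
    using card_le_inj[of "T - A" "A - T"] assms by auto
  define \<sigma> where "\<sigma> v = (if v \<in> T - A then f v
    else if v \<in> f ` (T - A) then inv_into (T - A) f v else v)" for v
  have 1: "\<sigma> v = f v" if "v \<in> T - A" for v
    using that by (simp add: \<sigma>_def)
  have 2: "\<sigma> (f v) = v" if "v \<in> T - A" for v
    using that f by (auto simp: \<sigma>_def)
  have 3: "\<sigma> v = v" if "v \<notin> T - A" "v \<notin> f ` (T - A)" for v
    using that by (auto simp: \<sigma>_def)
  show ?thesis
  proof
    show "\<sigma> (\<sigma> v) = v" for v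
      using 1 2 3[of v] by (cases "v \<in> T - A"; cases "v \<in> f ` (T - A)") auto
    show "\<sigma> v \<in> A" if "v \<in> T" for v
    proof -
      have "v \<notin> f ` (T - A)"
        using f(1) that by blast
      then show ?thesis
        using 1[of v] 3[of v] f(1) that by (cases "v \<in> A") auto
    qed
    show "\<sigma> v = v" if "v \<notin> T \<union> A" for v
      using 3[of v] f(1) that by auto
    show "\<sigma> v \<in> T \<union> A" if "v \<in> T \<union> A" for v
      using 1[of v] 2 3[of v] f(1) that by (cases "v \<in> T - A"; cases "v \<in> f ` (T - A)") auto
  qed
qed

abbreviation sparse :: "bool list \<Rightarrow> bool" where
  "sparse \<equiv> successively (\<lambda>a b. \<not> (a \<and> b))"

text \<open>Prefixing 0 or 10 to shorter sparse words gives the Fibonacci recursion, and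
  \<open>x = 25/16\<close> lies below the golden ratio, so \<open>x^2 \<le> x + 1\<close>.\<close>

lemma card_sparse_ge: "(25/16) ^ k \<le> real (card {v. length v = k \<and> sparse v})"
proof (induction k rule: induct_nat_012)
  case 0
  have "{v. length v = 0 \<and> sparse v} = {[]}"
    by auto
  then show ?case
    by simp
next
  case 1
  have "{v. length v = Suc 0 \<and> sparse v} = {[False], [True]}"
    by (auto simp: length_Suc_conv)
  then show ?case
    by simp
next
  case (ge2 k)
  let ?A = "\<lambda>k. {v. length v = k \<and> sparse v}"
  have fin: "finite (?A k)" for k
    by (rule finite_subset[OF _ finite_words[of k]]) auto
  have sub: "(#) False ` ?A (Suc k) \<union> (\<lambda>v. True # False # v) ` ?A k \<subseteq> ?A (Suc (Suc k))"
    by (auto simp: successively_Cons)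
  have "card (?A (Suc k)) + card (?A k)
      = card ((#) False ` ?A (Suc k)) + card ((\<lambda>v. True # False # v) ` ?A k)"
    by (simp add: card_image inj_on_def)
  also have "\<dots> = card ((#) False ` ?A (Suc k) \<union> (\<lambda>v. True # False # v) ` ?A k)"
    using fin by (intro card_Un_disjoint[symmetric]) auto
  also have "\<dots> \<le> card (?A (Suc (Suc k)))"
    by (rule card_mono[OF fin sub])
  finally have "real (card (?A (Suc k))) + real (card (?A k)) \<le> real (card (?A (Suc (Suc k))))"
    by linarith
  moreover have "(25/16::real) ^ Suc (Suc k) \<le> (25/16) ^ Suc k + (25/16) ^ k"
    by simp
  ultimately show ?case
    using ge2 by linarith
qed

section \<open>Windows of Bernoulli sequences\<close>

abbreviation weight :: "real \<Rightarrow> bool list \<Rightarrow> real" where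
  "weight p v \<equiv> prod_list (map (pmf (bernoulli_pmf p)) v)"

lemma weight_nonneg: "0 \<le> weight p v"
  by (induction v) auto

lemma sum_weight: "(\<Sum>v | length v = k. weight p v) = 1"
proof -
  have "(\<Sum>a\<in>UNIV. pmf (bernoulli_pmf p) a) = 1"
    by (rule sum_pmf_eq_1) auto
  then show ?thesis
    by (simp add: sum_words_prod_list)
qed

lemma weight_le_1: "weight p v \<le> 1"
proof -
  have "weight p v \<le> (\<Sum>u | length u = length v. weight p u)"
    by (rule member_le_sum) (auto simp: weight_nonneg finite_words)
  then show ?thesis
    by (simp add: sum_weight)
qed

lemma prob_space_bernoulli_measure: "prob_space (bernoulli_measure p)"
  unfolding bernoulli_measure_def by (intro prob_space_PiM prob_space_measure_pmf)

lemma space_bernoulli_measure [simp]: "space (bernoulli_measure p) = UNIV"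
  using sets_eq_imp_space_eq[OF sets_bernoulli_measure] by simp

lemma window_in_sets [measurable]: "{x. window x a k \<in> W} \<in> sets (bernoulli_measure p)"
  using measurable_sets[OF measurable_window[of "\<lambda>j. a + int j" "[0..<k]"], of W]
  by (simp add: window_def vimage_def sets_bernoulli_measure)

lemma measure_window_eq:
  assumes "length v = k"
  shows "measure (bernoulli_measure p) {x. window x a k = v} = weight p v"
proof -
  interpret product_prob_space "\<lambda>_::int. measure_pmf (bernoulli_pmf p)" UNIV
    by unfold_locales
  interpret B: prob_space "bernoulli_measure p"
    by (rule prob_space_bernoulli_measure)
  define I where "I = (\<lambda>j. a + int j) ` {..<k}"
  have eq: "{x. window x a k = v} = {x \<in> space (bernoulli_measure p). \<forall>i\<in>I. x i \<in> {v ! nat (i - a)}}"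
    using assms by (auto simp: I_def list_eq_iff_nth_eq)
  have "emeasure (bernoulli_measure p) {x. window x a k = v}
      = (\<Prod>i\<in>I. emeasure (measure_pmf (bernoulli_pmf p)) {v ! nat (i - a)})"
    unfolding eq unfolding bernoulli_measure_def
    by (rule emeasure_PiM_Collect) (auto simp: I_def)
  also have "\<dots> = (\<Prod>j<k. emeasure (measure_pmf (bernoulli_pmf p)) {v ! j})"
    unfolding I_def by (subst prod.reindex) (auto simp: inj_on_def)
  also have "\<dots> = ennreal (\<Prod>j<k. pmf (bernoulli_pmf p) (v ! j))"
    by (simp add: emeasure_pmf_single prod_ennreal)
  also have "(\<Prod>j<k. pmf (bernoulli_pmf p) (v ! j)) = weight p v"
    using assms by (simp add: prod.list_conv_set_nth atLeast0LessThan)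
  finally show ?thesis
    by (simp add: B.emeasure_eq_measure weight_nonneg)
qed

lemma measure_window:
  assumes "W \<subseteq> {v. length v = k}"
  shows "measure (bernoulli_measure p) {x. window x a k \<in> W} = (\<Sum>v\<in>W. weight p v)"
proof -
  interpret B: prob_space "bernoulli_measure p"
    by (rule prob_space_bernoulli_measure)
  have "finite W"
    using finite_subset[OF assms finite_words] .
  have sets: "{x. window x a k = v} \<in> B.events" for v
    using window_in_sets[where W = "{v}"] by simp
  have "{x. window x a k \<in> W} = (\<Union>v\<in>W. {x. window x a k = v})"
    by auto
  also have "B.prob \<dots> = (\<Sum>v\<in>W. B.prob {x. window x a k = v})"
    using \<open>finite W\<close> sets
    by (intro B.finite_measure_finite_Union) (auto simp: disjoint_family_on_def)
  also have "\<dots> = (\<Sum>v\<in>W. weight p v)"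
    using assms by (intro sum.cong refl measure_window_eq) auto
  finally show ?thesis .
qed

text \<open>The blocks are disjoint, hence independent. Instead of invoking independence, the
  induction builds the set of admissible words of length \<open>N * l\<close> by concatenation,
  under which weights multiply.\<close>

lemma measure_blocks_neq:
  assumes "length m = l"
  shows "{x. \<forall>j<N. window x (a + int (j * l)) l \<noteq> m} \<in> sets (bernoulli_measure p)" (is ?sets)
    and "measure (bernoulli_measure p) {x. \<forall>j<N. window x (a + int (j * l)) l \<noteq> m}
      = (1 - weight p m) ^ N" (is ?measure)
proof -
  have "\<exists>W \<subseteq> {v. length v = N * l}.
      (\<forall>x. window x a (N * l) \<in> W \<longleftrightarrow> (\<forall>j<N. window x (a + int (j * l)) l \<noteq> m)) \<and>
      (\<Sum>v\<in>W. weight p v) = (1 - weight p m) ^ N"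
  proof (induction N)
    case 0
    show ?case
      by (rule exI[of _ "{[]}"]) (auto simp: window_def)
  next
    case (Suc N)
    then obtain W where W: "W \<subseteq> {v. length v = N * l}"
      "\<And>x. window x a (N * l) \<in> W \<longleftrightarrow> (\<forall>j<N. window x (a + int (j * l)) l \<noteq> m)"
      "(\<Sum>v\<in>W. weight p v) = (1 - weight p m) ^ N"
      by metis
    define V where "V = {v. length v = l} - {m}"
    have V: "(\<Sum>v\<in>V. weight p v) = 1 - weight p m"
      unfolding V_def using assms by (simp add: sum_diff1 finite_words sum_weight)
    have inj: "inj_on (\<lambda>(u, v). u @ v) (W \<times> V)"
      using W(1) by (auto simp: inj_on_def V_def)
    define W' where "W' = (\<lambda>(u, v). u @ v) ` (W \<times> V)"
    have "window x a (Suc N * l) \<in> W' \<longleftrightarrow> (\<forall>j<Suc N. window x (a + int (j * l)) l \<noteq> m)" for x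
    proof -
      have "window x a (Suc N * l) = window x a (N * l) @ window x (a + int (N * l)) l"
        using window_add[of x a "N * l" l] by (simp add: add.commute)
      moreover have "u @ v \<in> W' \<longleftrightarrow> u \<in> W \<and> v \<in> V" if "length u = N * l" for u v
        using that W(1) by (auto simp: W'_def)
      ultimately show ?thesis
        using W(2)[of x] by (auto simp: V_def less_Suc_eq)
    qed
    moreover have "(\<Sum>v\<in>W'. weight p v) = (1 - weight p m) ^ Suc N"
    proof -
      have "(\<Sum>v\<in>W'. weight p v) = (\<Sum>(u, v)\<in>W \<times> V. weight p u * weight p v)"
        unfolding W'_def using inj by (subst sum.reindex) (auto intro!: sum.cong)
      also have "\<dots> = (\<Sum>u\<in>W. weight p u) * (\<Sum>v\<in>V. weight p v)"
        by (simp add: sum_product sum.cartesian_product)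
      finally show ?thesis
        by (simp add: W(3) V)
    qed
    moreover have "W' \<subseteq> {v. length v = Suc N * l}"
      using W(1) by (auto simp: W'_def V_def)
    ultimately show ?case
      by blast
  qed
  then obtain W where W: "W \<subseteq> {v. length v = N * l}"
    "\<And>x. (\<forall>j<N. window x (a + int (j * l)) l \<noteq> m) \<longleftrightarrow> window x a (N * l) \<in> W"
    "(\<Sum>v\<in>W. weight p v) = (1 - weight p m) ^ N"
    by metis
  show ?sets ?measure
    unfolding W(2) by (simp_all add: measure_window[OF W(1)] W(3) window_in_sets)
qed

section \<open>Likely words\<close>

text \<open>The threshold is the reciprocal of the growth rate in \<open>card_sparse_ge\<close>. The
  parameter 49/625 makes both letter probabilities squares, of 7/25 and 24/25.\<close>

definition likely :: "nat \<Rightarrow> bool list set" where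
  "likely k = {v. length v = k \<and> (16/25) ^ k \<le> weight (49/625) v}"

lemma finite_likely: "finite (likely k)"
  by (rule finite_subset[OF _ finite_words[of k]]) (auto simp: likely_def)

text \<open>Each likely word weighs at least \<open>(16/25) ^ k\<close>, and all words of length
  \<open>k\<close> together weigh 1.\<close>

lemma card_likely_le: "real (card (likely k)) \<le> (25/16) ^ k"
proof -
  have "real (card (likely k)) * (16/25) ^ k \<le> (\<Sum>v\<in>likely k. weight (49/625) v)"
    by (rule sum_bounded_below) (auto simp: likely_def)
  also have "\<dots> \<le> (\<Sum>v | length v = k. weight (49/625) v)"
    by (rule sum_mono2) (auto simp: finite_words likely_def weight_nonneg)
  finally have "real (card (likely k)) * (16/25) ^ k \<le> 1"
    by (simp add: sum_weight)
  then show ?thesis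
    by (simp add: field_simps)
qed

text \<open>An unlikely word \<open>v\<close> has \<open>weight v \<le> (4/5) ^ k * sqrt (weight v)\<close>, and the square roots of
  the weights sum to \<open>(7/25 + 24/25) ^ k\<close>.\<close>

lemma measure_not_likely_le:
  "measure (bernoulli_measure (49/625)) {x. window x a k \<notin> likely k} \<le> (124/125) ^ k"
proof -
  define r :: "bool \<Rightarrow> real" where "r b = (if b then 7/25 else 24/25)" for b
  define R where "R v = prod_list (map r v)" for v
  have R0: "0 \<le> R v" for v
    by (induction v) (auto simp: R_def r_def)
  have R2: "weight (49/625) v = (R v)\<^sup>2" for v
    by (induction v) (auto simp: R_def r_def power2_eq_square)
  define W where "W = {v. length v = k} - likely k"
  have "weight (49/625) v \<le> R v * (4/5) ^ k" if "v \<in> W" for v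
  proof -
    have "(R v)\<^sup>2 < (16/25) ^ k"
      using that by (auto simp: W_def likely_def R2)
    also have "(16/25::real) ^ k = ((4/5) ^ k)\<^sup>2"
      by (simp add: power2_eq_square flip: power_mult_distrib)
    finally have "R v < (4/5) ^ k"
      by (rule power_less_imp_less_base) simp
    then have "R v * R v \<le> R v * (4/5) ^ k"
      using R0 by (intro mult_left_mono) auto
    then show ?thesis
      by (simp add: R2 power2_eq_square)
  qed
  then have "(\<Sum>v\<in>W. weight (49/625) v) \<le> (\<Sum>v\<in>W. R v * (4/5) ^ k)"
    by (rule sum_mono)
  also have "\<dots> \<le> (\<Sum>v | length v = k. R v * (4/5) ^ k)"
    by (rule sum_mono2) (auto simp: finite_words W_def R0)
  also have "\<dots> = (31/25) ^ k * (4/5) ^ k"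
    by (simp add: R_def sum_words_prod_list UNIV_bool r_def flip: sum_distrib_right)
  also have "\<dots> = (124/125) ^ k"
    by (simp flip: power_mult_distrib)
  finally have "(\<Sum>v\<in>W. weight (49/625) v) \<le> (124/125) ^ k" .
  moreover have "{x. window x a k \<notin> likely k} = {x. window x a k \<in> W}"
    by (auto simp: W_def)
  ultimately show ?thesis
    using measure_window[of W k] by (simp add: W_def)
qed

text \<open>For each length there are at least as many sparse words as likely ones, so
  \<open>swap_into\<close> applies length by length.\<close>

lemma swap_likely_sparse:
  assumes m: "\<And>v. sparse v \<Longrightarrow> \<not> sublist m v"
  obtains \<sigma> where "\<And>v. length (\<sigma> v) = length v" "\<And>v. \<sigma> (\<sigma> v) = v"
    "\<And>v. sublist m (\<sigma> v) \<longleftrightarrow> sublist m v"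
    "\<And>v. v \<in> likely (length v) \<Longrightarrow> \<not> sublist m v \<Longrightarrow> sparse (\<sigma> v)"
proof -
  \<comment> \<open>Likely words containing \<open>m\<close> are left out of \<open>T\<close>: with
    \<open>A\<close> and \<open>T\<close> both marker-free, the swap respects
    \<open>sublist m\<close>. Gap contents are marker-free, so the omission costs nothing.\<close>
  define A T where "A k = {v. length v = k \<and> sparse v}"
    and "T k = {v \<in> likely k. \<not> sublist m v}" for k
  have "\<exists>\<sigma>. (\<forall>v. \<sigma> (\<sigma> v) = v) \<and> (\<forall>v \<in> T k. \<sigma> v \<in> A k) \<and>
     (\<forall>v. v \<notin> T k \<union> A k \<longrightarrow> \<sigma> v = v) \<and> (\<forall>v \<in> T k \<union> A k. \<sigma> v \<in> T k \<union> A k)" for k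
  proof -
    have "finite (A k)"
      by (rule finite_subset[OF _ finite_words[of k]]) (auto simp: A_def)
    moreover have "finite (T k)" "card (T k) \<le> card (likely k)"
      using finite_likely[of k] by (auto simp: T_def intro: card_mono)
    moreover have "real (card (likely k)) \<le> real (card (A k))"
      using card_likely_le[of k] card_sparse_ge[of k] by (simp add: A_def)
    ultimately have "finite (A k)" "finite (T k)" "card (T k) \<le> card (A k)"
      by simp_all
    from swap_into[OF this] show ?thesis
      by metis
  qed
  then obtain s where s: "\<And>k v. s k (s k v) = v" "\<And>k v. v \<in> T k \<Longrightarrow> s k v \<in> A k"
    "\<And>k v. v \<notin> T k \<union> A k \<Longrightarrow> s k v = v" "\<And>k v. v \<in> T k \<union> A k \<Longrightarrow> s k v \<in> T k \<union> A k"
    by metis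
  have TA: "length v = k \<and> \<not> sublist m v" if "v \<in> T k \<union> A k" for v k
    using that m by (auto simp: T_def A_def likely_def)
  define \<sigma> where "\<sigma> v = s (length v) v" for v
  show ?thesis
  proof
    show len: "length (\<sigma> v) = length v" for v
      unfolding \<sigma>_def using s(3,4) TA by metis
    show "\<sigma> (\<sigma> v) = v" for v
      using len[of v] s(1) by (simp add: \<sigma>_def)
    show "sublist m (\<sigma> v) \<longleftrightarrow> sublist m v" for v
      unfolding \<sigma>_def using s(3,4) TA by metis
    show "sparse (\<sigma> v)" if "v \<in> likely (length v)" "\<not> sublist m v" for v
      using s(2)[of v "length v"] that by (simp add: \<sigma>_def A_def T_def)
  qed
qed

section \<open>Pushing a Bernoulli measure onto sparse words\<close>

text \<open>The three terms bound the bad events: no marker among \<open>N\<close> blocks on one of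
  the two sides, a marker starting within \<open>2 * l\<close> of the observed cell, and an unlikely
  gap content.\<close>

lemma exists_reversible_ca_measure_le:
  fixes m :: "bool list" and N :: nat
  assumes unbordered: "\<And>j. 0 < j \<Longrightarrow> j < length m \<Longrightarrow> drop j m \<noteq> take (length m - j) m"
    and m: "\<And>v. sparse v \<Longrightarrow> \<not> sublist m v"
  defines "q \<equiv> weight (49/625) m" and "l \<equiv> length m"
  shows "\<exists>F. reversible_ca F \<and>
    measure (image_measure F (bernoulli_measure (49/625))) (cylinder [True, True])
      \<le> 2 * (1 - q) ^ N + real (4 * l + 1) * q + 15625 * (124/125) ^ (3 * l)"
proof -
  obtain \<sigma> where \<sigma>: "\<And>v. length (\<sigma> v) = length v" "\<And>v. \<sigma> (\<sigma> v) = v"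
    "\<And>v. sublist m (\<sigma> v) \<longleftrightarrow> sublist m v"
    "\<And>v. v \<in> likely (length v) \<Longrightarrow> \<not> sublist m v \<Longrightarrow> sparse (\<sigma> v)"
    using swap_likely_sparse[OF m] by metis
  define J where "J = N * l"
  \<comment> \<open>Markers are sought within distance \<open>J\<close> on either side, so the gap
    found has length at most \<open>2 * J\<close>.\<close>
  define K where "K = 2 * J"
  interpret gap_refill m K \<sigma>
    by unfold_locales (use unbordered \<sigma> in auto)
  interpret B: prob_space "bernoulli_measure (49/625)"
    by (rule prob_space_bernoulli_measure)
  have "m \<noteq> []"
    using m[of "[]"] by auto
  define G where "G x i = refill x (i + int K)" for x i
  have rev: "reversible_ca G"
    using reversible_ca_refill[OF \<open>m \<noteq> []\<close>] by (simp add: G_def[abs_def])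
  \<comment> \<open>Because of the translation in \<open>G\<close>, its cells 0 and 1 are the cells
    \<open>c\<close> and \<open>c + 1\<close> of \<open>refill x\<close>.\<close>
  define c where "c = int K"
  have l: "0 < l" "M = int l"
    using \<open>m \<noteq> []\<close> by (auto simp: l_def)

  define E1 where "E1 = {x. \<forall>j<N. window x (c - int J + int (j * l)) l \<noteq> m}"
  define E2 where "E2 = {x. \<forall>j<N. window x (c + 1 + int (j * l)) l \<noteq> m}"
  define E3 where "E3 = (\<Union>j\<in>{..4 * l}. {x. window x (c - 2 * int l + int j) l \<in> {m}})"
  \<comment> \<open>This fixed window is the gap content when the markers start at
    \<open>c - 2 * l - a\<close> and \<open>c + 2 * l + b\<close>. A union bound over all
    \<open>a\<close> and \<open>b\<close> replaces conditioning on the random gap.\<close>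
  define D where "D = (\<lambda>(a, b). {x. window x (c - int l - int a) (3 * l + a + b) \<notin> likely (3 * l + a + b)})"
  define E4 where "E4 = (\<Union>ab\<in>{..<J} \<times> {..<J}. D ab)"
  have D_sets: "D ab \<in> B.events" for ab
    unfolding D_def using window_in_sets[where W = "- likely (3 * l + fst ab + snd ab)"]
    by (simp add: case_prod_beta)
  have sets: "E1 \<in> B.events" "E2 \<in> B.events" "E3 \<in> B.events" "E4 \<in> B.events"
    unfolding E1_def E2_def E3_def E4_def
    by (intro measure_blocks_neq(1) sets.finite_UN D_sets window_in_sets; simp add: l_def)+

  have "G -` cylinder [True, True] \<subseteq> E1 \<union> E2 \<union> (E3 \<union> E4)"
  proof (rule subsetI, rule ccontr)
    fix x assume "x \<in> G -` cylinder [True, True]" and good: "x \<notin> E1 \<union> E2 \<union> (E3 \<union> E4)"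
    then have "G x (int i)" if "i < 2" for i
      using that by (auto simp: cylinder_def less_Suc_eq numeral_2_eq_2)
    from this[of 0] this[of 1] have x: "refill x c" "refill x (c + 1)"
      by (simp_all add: G_def c_def add.commute)
    have inJ: "int j * int l + int l \<le> int J" if "j < N" for j
    proof -
      have "j * l + l \<le> J"
        using mult_le_mono1[of "Suc j" N l] that by (simp add: J_def add.commute)
      then show ?thesis
        by (metis of_nat_add of_nat_le_iff of_nat_mult)
    qed
    define S where "S = {s \<in> {c - int J..c}. marked x s}"
    define S' where "S' = {s \<in> {c + 1..c + int J}. marked x s}"
    obtain j where "j < N" "marked x (c - int J + int (j * l))"
      using good by (auto simp: E1_def marked_def l_def)
    with inJ[of j] have "c - int J + int (j * l) \<in> S"
      by (simp add: S_def)
    then have S: "finite S" "S \<noteq> {}"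
      unfolding S_def by (blast intro: finite_subset[OF _ finite_atLeastAtMost_int])+
    obtain j where "j < N" "marked x (c + 1 + int (j * l))"
      using good by (auto simp: E2_def marked_def l_def)
    with inJ[of j] l have "c + 1 + int (j * l) \<in> S'"
      by (simp add: S'_def)
    then have S': "finite S'" "S' \<noteq> {}"
      unfolding S'_def by (blast intro: finite_subset[OF _ finite_atLeastAtMost_int])+
    \<comment> \<open>The last marker starting at or before \<open>c\<close> and the first one after
      it are consecutive, so they bound a gap.\<close>
    define s t where "s = Max S" and "t = Min S'"
    have s: "s \<in> S" "\<And>r. r \<in> S \<Longrightarrow> r \<le> s" and t: "t \<in> S'" "\<And>r. r \<in> S' \<Longrightarrow> t \<le> r"
      using S S' by (auto simp: s_def t_def)
    have far: "\<not> marked x r" if "c - 2 * int l \<le> r" "r \<le> c + 2 * int l" for r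
    proof
      assume "marked x r"
      then have "x \<in> E3"
        unfolding E3_def using that
        by (intro UN_I[of "nat (r - c + 2 * int l)"]) (auto simp: marked_def l_def)
      then show False
        using good by simp
    qed
    have st: "marked x s" "marked x t" "c - int J \<le> s" "s \<le> c" "c + 1 \<le> t" "t \<le> c + int J"
      using s(1) t(1) by (auto simp: S_def S'_def)
    then have st': "s < c - 2 * int l" "c + 2 * int l < t"
      using far[of s] far[of t] by linarith+
    have "\<not> marked x r" if "s < r" "r < t" for r
      using s(2)[of r] t(2)[of r] st that by (cases "r \<le> c") (auto simp: S_def S'_def)
    moreover have "t \<le> s + int K"
      using st by (simp add: K_def)
    ultimately have gap: "gap x s t"
      using st by (auto simp: gap_def)
    then have cov: "covers x c s t" "covers x (c + 1) s t"
      using st' l by (auto simp: covers_def)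
    define a b where "a = nat (c - 2 * int l - s)" and "b = nat (t - c - 2 * int l)"
    have len: "nat (t - s - M) = 3 * l + a + b" "s + M = c - int l - int a"
      using st' l by (auto simp: a_def b_def)
    have "a < J" "b < J"
      using st st' l by (auto simp: a_def b_def)
    then have "x \<notin> D (a, b)"
      using good by (auto simp: E4_def)
    then have "content x s t \<in> likely (length (content x s t))"
      unfolding content_def len by (simp add: D_def)
    then have "sparse (\<sigma> (content x s t))"
      using \<sigma>(4) not_sublist_content[OF gap \<open>m \<noteq> []\<close>] by blast
    \<comment> \<open>The cells \<open>c\<close> and \<open>c + 1\<close> are adjacent letters of
      the refilled content, where sparseness forbids two ones.\<close>
    moreover have "Suc (nat (c - s - M)) < length (\<sigma> (content x s t))" "nat (c + 1 - s - M) = Suc (nat (c - s - M))"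
      using st' l by (auto simp: content_def \<sigma>(1))
    ultimately show False
      using x refill_covered[OF cov(1)] refill_covered[OF cov(2)]
      by (auto simp: successively_conv_nth)
  qed
  then have "B.prob (G -` cylinder [True, True]) \<le> B.prob (E1 \<union> E2 \<union> (E3 \<union> E4))"
    by (rule B.finite_measure_mono) (use sets in auto)
  also have "\<dots> \<le> (B.prob E1 + B.prob E2) + (B.prob E3 + B.prob E4)"
    using sets by (intro order.trans[OF measure_Un_le] add_mono measure_Un_le) auto
  also have "B.prob E1 = (1 - q) ^ N"
    unfolding E1_def q_def by (rule measure_blocks_neq) (simp add: l_def)
  also have "B.prob E2 = (1 - q) ^ N"
    unfolding E2_def q_def by (rule measure_blocks_neq) (simp add: l_def)
  also have "B.prob E3 \<le> real (4 * l + 1) * q"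
  proof -
    have "B.prob E3 \<le> (\<Sum>j\<in>{..4 * l}. B.prob {x. window x (c - 2 * int l + int j) l \<in> {m}})"
      unfolding E3_def
      by (rule B.finite_measure_subadditive_finite) (use window_in_sets in blast)+
    also have "\<dots> = (\<Sum>j\<in>{..4 * l}. q)"
      by (intro sum.cong refl) (simp add: measure_window_eq l_def q_def)
    finally show ?thesis
      by (simp add: algebra_simps)
  qed
  also have "B.prob E4 \<le> 15625 * (124/125) ^ (3 * l)"
  proof -
    have "B.prob E4 \<le> (\<Sum>ab\<in>{..<J} \<times> {..<J}. B.prob (D ab))"
      unfolding E4_def using D_sets by (intro B.finite_measure_subadditive_finite) auto
    also have "\<dots> \<le> (\<Sum>(a, b)\<in>{..<J} \<times> {..<J}. (124/125) ^ (3 * l + a + b))"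
      using measure_not_likely_le by (intro sum_mono) (auto simp: D_def)
    also have "\<dots> = (124/125) ^ (3 * l) * ((\<Sum>a<J. (124/125) ^ a) * (\<Sum>b<J. (124/125) ^ b))"
      unfolding sum_product sum.cartesian_product
      by (simp add: sum_distrib_left case_prod_beta power_add mult.assoc)
    also have "\<dots> \<le> (124/125) ^ (3 * l) * (125 * 125)"
    proof -
      \<comment> \<open>The full geometric series sums to \<open>1 / (1 - 124/125) = 125\<close>,
        uniformly in \<open>J\<close> and hence in \<open>N\<close>.\<close>
      have "(\<Sum>a<J. (124/125::real) ^ a) \<le> 125"
        by (simp add: sum_gp_strict)
      then show ?thesis
        by (intro mult_left_mono mult_mono) (auto intro: sum_nonneg)
    qed
    finally show ?thesis
      by simp
  qed
  finally have "B.prob (G -` cylinder [True, True])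
      \<le> 2 * (1 - q) ^ N + real (4 * l + 1) * q + 15625 * (124/125) ^ (3 * l)"
    by simp
  moreover have "measure (image_measure G (bernoulli_measure (49/625))) (cylinder [True, True])
      = B.prob (G -` cylinder [True, True])"
    using rev by (intro measure_image_cylinder sets_bernoulli_measure) (simp add: reversible_ca_def)
  ultimately show ?thesis
    using rev by metis
qed

section \<open>Concrete markers and passage to the limit\<close>

definition marker :: "nat \<Rightarrow> bool list" where
  "marker n = True # True # replicate (Suc n) False"

lemma length_marker: "length (marker n) = n + 3"
  by (simp add: marker_def)

text \<open>A border at shift \<open>j\<close> needs a one at position \<open>j\<close>, so
  \<open>j = 1\<close>; then position 2 must also be a one, but \<open>Suc n\<close> guarantees a
  zero there.\<close>

lemma unbordered_marker:
  assumes "0 < j" "j < length (marker n)"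
  shows "drop j (marker n) \<noteq> take (length (marker n) - j) (marker n)"
proof
  assume eq: "drop j (marker n) = take (length (marker n) - j) (marker n)"
  have nth: "marker n ! (j + i) = marker n ! i" if "j + i < length (marker n)" for i
    using arg_cong[OF eq, of "\<lambda>v. v ! i"] that by simp
  have high: "\<not> marker n ! i" if "2 \<le> i" "i < length (marker n)" for i
    using that by (auto simp: marker_def nth_Cons split: nat.splits simp del: replicate_Suc)
  show False
  proof (cases "j = 1")
    case True
    then show False
      using nth[of 1] high[of 2] by (simp add: length_marker marker_def)
  next
    case False
    then show False
      using nth[of 0] high[of j] assms by (simp add: marker_def)
  qed
qed

lemma not_sublist_marker: "sparse v \<Longrightarrow> \<not> sublist (marker n) v"
  by (auto simp: sublist_def marker_def successively_append_iff)

lemma weight_marker: "weight (49/625) (marker n) = (49/625)\<^sup>2 * (576/625) ^ Suc n"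
  by (simp add: marker_def power2_eq_square)

theorem theorem1:
  shows "\<exists>(p::real) (F :: nat \<Rightarrow> bool config \<Rightarrow> bool config) (w :: bool list).
           0 < p \<and> p < 1 \<and> (\<forall>n. reversible_ca (F n)) \<and>
           (\<lambda>n. measure (image_measure (F n) (bernoulli_measure p)) (cylinder w)) \<longlonglongrightarrow> 0 \<and>
           (\<forall>\<nu>. weak_star_limit_point (\<lambda>n. image_measure (F n) (bernoulli_measure p)) \<nu> \<longrightarrow>
                 \<not> full_support \<nu>)"
proof -
  let ?p = "49/625 :: real" and ?w = "[True, True]"
  define q :: "nat \<Rightarrow> real" where "q n = (49/625)\<^sup>2 * (576/625) ^ Suc n" for n
  define e :: "nat \<Rightarrow> real" where
    "e n = 2 * (1 / real (Suc n)) + real (4 * (n + 3) + 1) * q n + 15625 * (124/125) ^ (3 * (n + 3))" for n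
  have "\<exists>F. reversible_ca F \<and> measure (image_measure F (bernoulli_measure ?p)) (cylinder ?w) \<le> e n" for n
  proof -
    have "0 < q n" "q n \<le> 1"
      using weight_le_1[of ?p "marker n"] by (simp_all add: q_def weight_marker)
    \<comment> \<open>Only the first error term depends on \<open>N\<close>, so \<open>N\<close> may
      be chosen after the marker, however large.\<close>
    then obtain N where "(1 - q n) ^ N < 1 / real (Suc n)"
      using real_arch_pow_inv[of "1 / real (Suc n)" "1 - q n"] by auto
    then show ?thesis
      using exists_reversible_ca_measure_le[of "marker n" N, OF unbordered_marker not_sublist_marker]
      unfolding weight_marker length_marker e_def q_def[symmetric] by force
  qed
  then obtain F where F: "\<And>n. reversible_ca (F n)"
    "\<And>n. measure (image_measure (F n) (bernoulli_measure ?p)) (cylinder ?w) \<le> e n"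
    by metis
  have "e \<longlonglongrightarrow> 0"
  proof -
    define C :: real where "C = (49/625)\<^sup>2 * (576/625)"
    \<comment> \<open>The factor \<open>4 * (n + 3) + 1 = 4 * n + 13\<close> splits the middle term;
      every summand then has a standard null sequence as a factor.\<close>
    have "e = (\<lambda>n. 2 * inverse (real (Suc n)) + 4 * C * (real n * (576/625) ^ n) + 13 * C * (576/625) ^ n
        + 15625 * (124/125) ^ 9 * ((124/125) ^ 3) ^ n)"
      unfolding e_def q_def C_def power_mult[symmetric]
      by (auto simp: fun_eq_iff algebra_simps power_add inverse_eq_divide)
    moreover have "\<dots> \<longlonglongrightarrow> 2 * 0 + 4 * C * 0 + 13 * C * 0 + 15625 * (124/125) ^ 9 * 0"
      by (intro tendsto_add tendsto_mult_left LIMSEQ_inverse_real_of_nat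
          powser_times_n_limit_0 LIMSEQ_realpow_zero) (auto simp: power_less_one_iff)
    ultimately show ?thesis
      by simp
  qed
  have lim: "(\<lambda>n. measure (image_measure (F n) (bernoulli_measure ?p)) (cylinder ?w)) \<longlonglongrightarrow> 0"
    by (rule tendsto_sandwich[OF _ _ tendsto_const \<open>e \<longlonglongrightarrow> 0\<close>]) (auto simp: F(2))
  have "\<not> full_support \<nu>"
    if \<nu>: "weak_star_limit_point (\<lambda>n. image_measure (F n) (bernoulli_measure ?p)) \<nu>" for \<nu>
  proof -
    obtain s where s: "strict_mono s"
      "weak_star_converges ((\<lambda>n. image_measure (F n) (bernoulli_measure ?p)) \<circ> s) \<nu>"
      using \<nu> by (auto simp: weak_star_limit_point_def)
    then have "(\<lambda>n. measure (image_measure (F (s n)) (bernoulli_measure ?p)) (cylinder ?w))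
        \<longlonglongrightarrow> measure \<nu> (cylinder ?w)"
      by (simp add: weak_star_converges_def o_def)
    moreover have "(\<lambda>n. measure (image_measure (F (s n)) (bernoulli_measure ?p)) (cylinder ?w)) \<longlonglongrightarrow> 0"
      using LIMSEQ_subseq_LIMSEQ[OF lim s(1)] by (simp add: o_def)
    ultimately have "measure \<nu> (cylinder ?w) = 0"
      by (rule LIMSEQ_unique)
    then show ?thesis
      by (metis full_support_def less_irrefl)
  qed
  then show ?thesis
    using F(1) lim by (intro exI[of _ ?p] exI[of _ F] exI[of _ ?w]) auto
qed

end
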